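(* Let $\mu$ and $\nu$ be two probability measures on the real line with finite supports $X=\{x(1),\ldots,x(m_1)\}$ and $Y=\{y(1),\ldots,y(m_2)\}$ respectively, where $m_1=\#\mathrm{supp}(\mu)$ and $m_2=\#\mathrm{supp}(\nu)$. For $n\in\mathbb{N}$ let $$\rho_n=\min_{\boldsymbol{\phi},\boldsymbol{\psi}\in\mathbb{R}^{2n+1}}\Big\{\phi_0+\psi_0:\ \phi_k-\psi_k=\mu_k-\nu_k,\ k=0,\ldots,2n;\quad 0\preceq \mathbf{M}_n(\boldsymbol{\phi})\preceq \mathbf{M}_n(\mu);\quad 0\preceq \mathbf{M}_n(\boldsymbol{\psi})\preceq \mathbf{M}_n(\nu)\Big\}.$$ Then $\rho_n=\Vert\mu-\nu\Vert_{TV}$ for all $n\ge\max[m_1,m_2]$. In particular, if $X\cap Y=\emptyset$ (i.e., if $\mu$ and $\nu$ are mutually singular) then $\rho_n=2$ for all $n\ge\max[m_1,m_2]$.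
   Context: For a measure $\mu$ on $\mathbb{R}$ with finite moments, $\mu_k=\int x^k\,d\mu$. For a real vector $\boldsymbol{\phi}=(\phi_0,\ldots,\phi_{2n})$, $\mathbf{M}_n(\boldsymbol{\phi})$ is the $(n+1)\times(n+1)$ Hankel moment matrix with entries $\mathbf{M}_n(\boldsymbol{\phi})(i,j)=\phi_{i+j}$, $0\le i,j\le n$; $\mathbf{M}_n(\mu)$ is the moment matrix of $(\mu_0,\ldots,\mu_{2n})$. $\mathbf{A}\succeq0$ means positive semidefinite, and $\mathbf{A}\preceq\mathbf{B}$ means $\mathbf{B}-\mathbf{A}\succeq0$. $\Vert\mu-\nu\Vert_{TV}=\phi^*_+(\mathbb{R})+\phi^*_-(\mathbb{R})$, where $(\phi^*_+,\phi^*_-)$ is the Hahn-Jordan decomposition of $\mu-\nu$, i.e. the unique pair of mutually singular positive measures with $\phi^*_+-\phi^*_-=\mu-\nu$ (so no factor $1/2$). *)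

theory Defs
  imports "HOL-Probability.Probability" "Jordan_Normal_Form.Matrix"
begin

unbundle no vec_syntax
hide_const (open) Finite_Cartesian_Product.vec

section \<open>Support, mutual singularity and total variation\<close>

definition supp :: "'a::topological_space measure \<Rightarrow> 'a set" where
  "supp M = {x. \<forall>U. open U \<longrightarrow> x \<in> U \<longrightarrow> emeasure M U > 0}"

definition mutually_singular :: "'a measure \<Rightarrow> 'a measure \<Rightarrow> bool" where
  "mutually_singular M N \<longleftrightarrow>
     (\<exists>A. A \<in> sets M \<and> A \<in> sets N \<and> emeasure M (space M - A) = 0 \<and> emeasure N A = 0)"

text \<open>There is no type of signed measures: \<open>P - Q = M - N\<close> is stated set by set. Finiteness of
  \<open>P\<close> and \<open>Q\<close> is required because \<^const>\<open>measure\<close> is zero on sets of infinite measure.\<close>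

definition jordan_decomposition ::
    "'a measure \<Rightarrow> 'a measure \<Rightarrow> 'a measure \<Rightarrow> 'a measure \<Rightarrow> bool" where
  "jordan_decomposition M N P Q \<longleftrightarrow>
     finite_measure P \<and> finite_measure Q \<and> sets P = sets M \<and> sets Q = sets M \<and>
     mutually_singular P Q \<and>
     (\<forall>A\<in>sets M. measure P A - measure Q A = measure M A - measure N A)"

text \<open>The norm of \<open>M - N\<close>, without the factor \<open>1/2\<close>.\<close>

definition tv_norm_diff :: "'a measure \<Rightarrow> 'a measure \<Rightarrow> real" where
  "tv_norm_diff M N =
     (case (THE (P, Q). jordan_decomposition M N P Q) of
        (P, Q) \<Rightarrow> measure P (space M) + measure Q (space M))"

text \<open>The definite description above is well defined for finite measures.\<close>

lemma jordan_decomposition_exists: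
  assumes M: "finite_measure M" and N: "finite_measure N" and s: "sets N = sets M"
  shows "\<exists>P Q. jordan_decomposition M N P Q"
proof -
  interpret M: finite_measure M by fact
  interpret N: finite_measure N by fact
  have sp: "space N = space M" using s by (rule sets_eq_imp_space_eq)
  obtain Y where Y: "Y \<in> sets M"
    and Y1: "\<And>X. X \<in> sets M \<Longrightarrow> X \<subseteq> Y \<Longrightarrow> emeasure N X \<le> emeasure M X"
    and Y2: "\<And>X. X \<in> sets M \<Longrightarrow> X \<inter> Y = {} \<Longrightarrow> emeasure M X \<le> emeasure N X"
    using finite_unsigned_Hahn_decomposition[OF M N s] by metis
  define Z where "Z = space M - Y"
  have Z: "Z \<in> sets M" "Z \<in> sets N" "Y \<in> sets N" using Y s by (auto simp: Z_def)
  define R where "R L W = density L (indicator W)" for L :: "'a measure" and W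
  have eR: "emeasure (R L W) A = emeasure L (A \<inter> W)"
    if "sets L = sets M" "A \<in> sets M" "W \<in> sets M" for L W A
  proof -
    have "emeasure (R L W) A = (\<integral>\<^sup>+x. indicator (A \<inter> W) x \<partial>L)"
      unfolding R_def using that
      by (subst emeasure_density) (auto intro!: nn_integral_cong split: split_indicator simp del: nn_integral_indicator)
    also have "\<dots> = emeasure L (A \<inter> W)"
      using that by (intro nn_integral_indicator) auto
    finally show ?thesis .
  qed
  have sR: "sets (R L W) = sets L" "space (R L W) = space L" for L W
    by (simp_all add: R_def)
  have fR: "finite_measure (R L W)" if "finite_measure L" "sets L = sets M" "W \<in> sets M" for L W
  proof (rule finite_measureI)
    interpret L: finite_measure L by fact
    have sl: "space L = space M" using that(2) by (rule sets_eq_imp_space_eq)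
    have "emeasure (R L W) (space M) = emeasure L (space M \<inter> W)"
      using that by (intro eR) auto
    then show "emeasure (R L W) (space (R L W)) \<noteq> \<infinity>"
      by (simp add: sR sl)
  qed
  define P where "P = diff_measure (R M Y) (R N Y)"
  define Q where "Q = diff_measure (R N Z) (R M Z)"
  have eP: "emeasure P A = emeasure M (A \<inter> Y) - emeasure N (A \<inter> Y)" if A: "A \<in> sets M" for A
    unfolding P_def
    using A Y s by (subst emeasure_diff_measure) (auto simp: sR eR intro!: fR M N Y1)
  have eQ: "emeasure Q A = emeasure N (A \<inter> Z) - emeasure M (A \<inter> Z)" if A: "A \<in> sets M" for A
    unfolding Q_def
    using A Z s by (subst emeasure_diff_measure) (auto simp: sR eR intro!: fR M N Y2, auto simp: Z_def)
  have sP: "sets P = sets M" "space P = space M" "sets Q = sets M" "space Q = space M"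
    by (simp_all add: P_def Q_def sR s sp)
  have "emeasure P (space M) \<noteq> \<infinity>" "emeasure Q (space M) \<noteq> \<infinity>"
    by (simp_all add: eP eQ)
  then have fP: "finite_measure P" "finite_measure Q"
    by (auto intro!: finite_measureI simp: sP)
  have mP: "measure P A = measure M (A \<inter> Y) - measure N (A \<inter> Y)" if A: "A \<in> sets M" for A
  proof -
    have "emeasure N (A \<inter> Y) \<le> emeasure M (A \<inter> Y)"
      using A Y by (intro Y1) (auto simp: Z_def)
    then have "measure N (A \<inter> Y) \<le> measure M (A \<inter> Y)"
      by (simp add: M.emeasure_eq_measure N.emeasure_eq_measure)
    moreover have "emeasure P A = ennreal (measure M (A \<inter> Y) - measure N (A \<inter> Y))"
      by (simp add: eP[OF A] M.emeasure_eq_measure N.emeasure_eq_measure ennreal_minus)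
    ultimately show ?thesis by (simp add: measure_eq_emeasure_eq_ennreal)
  qed
  have mQ: "measure Q A = measure N (A \<inter> Z) - measure M (A \<inter> Z)" if A: "A \<in> sets M" for A
  proof -
    have "emeasure M (A \<inter> Z) \<le> emeasure N (A \<inter> Z)"
      using A Z by (intro Y2) (auto simp: Z_def)
    then have "measure M (A \<inter> Z) \<le> measure N (A \<inter> Z)"
      by (simp add: M.emeasure_eq_measure N.emeasure_eq_measure)
    moreover have "emeasure Q A = ennreal (measure N (A \<inter> Z) - measure M (A \<inter> Z))"
      by (simp add: eQ[OF A] M.emeasure_eq_measure N.emeasure_eq_measure ennreal_minus)
    ultimately show ?thesis by (simp add: measure_eq_emeasure_eq_ennreal)
  qed
  have split: "measure L A = measure L (A \<inter> Y) + measure L (A \<inter> Z)"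
    if A: "A \<in> sets M" and "finite_measure L" and L: "sets L = sets M" for L A
  proof -
    have "A = (A \<inter> Y) \<union> (A \<inter> Z)"
      using sets.sets_into_space[OF A] by (auto simp: Z_def)
    moreover have "measure L ((A \<inter> Y) \<union> (A \<inter> Z)) = measure L (A \<inter> Y) + measure L (A \<inter> Z)"
      using A Y Z L by (intro finite_measure.finite_measure_Union that) (auto simp: Z_def)
    ultimately show ?thesis by simp
  qed
  have "mutually_singular P Q"
    unfolding mutually_singular_def using Y
    by (intro exI[of _ Y]) (auto simp: sP eP eQ Z_def Int_commute)
  moreover have "measure P A - measure Q A = measure M A - measure N A" if A: "A \<in> sets M" for A
    using split[OF A M refl] split[OF A N s] mP[OF A] mQ[OF A] by simp
  ultimately show ?thesis
    unfolding jordan_decomposition_def using fP sP by blast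
qed

lemma jordan_decomposition_unique:
  assumes "jordan_decomposition M N P Q" "jordan_decomposition M N P' Q'"
  shows "P = P' \<and> Q = Q'"
proof -
  have le: "measure P A \<le> measure P' A"
    if d: "jordan_decomposition M N P Q" "jordan_decomposition M N P' Q'" and A: "A \<in> sets M"
    for P Q P' Q' and A
  proof -
    interpret P: finite_measure P using d by (simp add: jordan_decomposition_def)
    interpret P': finite_measure P' using d by (simp add: jordan_decomposition_def)
    have s: "sets P = sets M" "sets Q = sets M" "sets P' = sets M"
      using d by (auto simp: jordan_decomposition_def)
    have sp: "space P = space M" using s(1) by (rule sets_eq_imp_space_eq)
    obtain H where H: "H \<in> sets M" "emeasure P (space M - H) = 0" "emeasure Q H = 0"
      using d(1) s sp unfolding jordan_decomposition_def mutually_singular_def by auto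
    have AH: "A \<inter> H \<in> sets M" using A H by auto
    have "emeasure Q (A \<inter> H) = 0"
      by (rule emeasure_eq_0[of H]) (use H(1,3) s in auto)
    then have q: "measure Q (A \<inter> H) = 0" by (simp add: measure_def)
    have "emeasure P (A - H) = 0"
      by (rule emeasure_eq_0[of "space M - H"]) (use H(1,2) s sets.sets_into_space[OF A] in auto)
    then have "measure P (A - H) = 0" by (simp add: measure_def)
    then have "measure P A = measure P (A \<inter> H)"
      using P.finite_measure_Union[of "A \<inter> H" "A - H"] A H s by (auto simp: Int_Diff_Un)
    also have "\<dots> \<le> measure P' (A \<inter> H)"
    proof -
      have "measure P (A \<inter> H) - measure Q (A \<inter> H) = measure P' (A \<inter> H) - measure Q' (A \<inter> H)"
        using d AH by (simp add: jordan_decomposition_def)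
      then show ?thesis using q measure_nonneg[of Q' "A \<inter> H"] by linarith
    qed
    also have "\<dots> \<le> measure P' A" using A s by (intro P'.finite_measure_mono) auto
    finally show ?thesis .
  qed
  have mP: "measure P A = measure P' A" if "A \<in> sets M" for A
    using le[OF assms that] le[OF assms(2,1) that] by simp
  have mQ: "measure Q A = measure Q' A" if "A \<in> sets M" for A
  proof -
    have "measure P A - measure Q A = measure P' A - measure Q' A"
      using assms that by (simp add: jordan_decomposition_def)
    then show ?thesis using mP[OF that] by linarith
  qed
  have "P = P'"
  proof (rule measure_eqI)
    show "sets P = sets P'" using assms by (simp add: jordan_decomposition_def)
    fix A assume "A \<in> sets P"
    then have "A \<in> sets M" using assms by (simp add: jordan_decomposition_def)
    moreover have "finite_measure P" "finite_measure P'"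
      using assms by (simp_all add: jordan_decomposition_def)
    ultimately show "emeasure P A = emeasure P' A"
      by (metis mP finite_measure.emeasure_eq_measure)
  qed
  moreover have "Q = Q'"
  proof (rule measure_eqI)
    show "sets Q = sets Q'" using assms by (simp add: jordan_decomposition_def)
    fix A assume "A \<in> sets Q"
    then have "A \<in> sets M" using assms by (simp add: jordan_decomposition_def)
    moreover have "finite_measure Q" "finite_measure Q'"
      using assms by (simp_all add: jordan_decomposition_def)
    ultimately show "emeasure Q A = emeasure Q' A"
      by (metis mQ finite_measure.emeasure_eq_measure)
  qed
  ultimately show ?thesis by simp
qed

lemma tv_norm_diff_eq:
  assumes "jordan_decomposition M N P Q"
  shows "tv_norm_diff M N = measure P (space M) + measure Q (space M)"
proof -
  have "(THE (P, Q). jordan_decomposition M N P Q) = (P, Q)"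
  proof (rule the_equality)
    show "case (P, Q) of (P, Q) \<Rightarrow> jordan_decomposition M N P Q" using assms by simp
    fix z assume z: "case z of (P, Q) \<Rightarrow> jordan_decomposition M N P Q"
    obtain P' Q' where "z = (P', Q')" by (cases z)
    with z jordan_decomposition_unique[OF assms, of P' Q'] show "z = (P, Q)" by simp
  qed
  then show ?thesis by (simp add: tv_norm_diff_def)
qed

section \<open>Moment matrices\<close>

definition moment :: "real measure \<Rightarrow> nat \<Rightarrow> real" where
  "moment M k = (\<integral>x. x ^ k \<partial>M)"

definition moment_vec :: "nat \<Rightarrow> real measure \<Rightarrow> real Matrix.vec" where
  "moment_vec n M = Matrix.vec (2 * n + 1) (moment M)"

definition moment_matrix :: "nat \<Rightarrow> real Matrix.vec \<Rightarrow> real Matrix.mat" where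
  "moment_matrix n \<phi> = Matrix.mat (n + 1) (n + 1) (\<lambda>(i, j). \<phi> $ (i + j))"

definition psd :: "real Matrix.mat \<Rightarrow> bool" where
  "psd A \<longleftrightarrow> square_mat A \<and> transpose_mat A = A \<and>
     (\<forall>v\<in>carrier_vec (dim_row A). 0 \<le> scalar_prod v (A *\<^sub>v v))"

text \<open>\<open>B - A\<close> takes its dimensions from \<open>A\<close>, so equality of the dimensions is required
  separately.\<close>

definition loewner_le :: "real Matrix.mat \<Rightarrow> real Matrix.mat \<Rightarrow> bool" (infix \<open>\<preceq>\<^sub>L\<close> 50) where
  "A \<preceq>\<^sub>L B \<longleftrightarrow> dim_row A = dim_row B \<and> dim_col A = dim_col B \<and> psd (B - A)"

section \<open>The optimization problem\<close>

definition feasible ::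
    "nat \<Rightarrow> real measure \<Rightarrow> real measure \<Rightarrow> real Matrix.vec \<times> real Matrix.vec \<Rightarrow> bool" where
  "feasible n \<mu> \<nu> = (\<lambda>(\<phi>, \<psi>).
     \<phi> \<in> carrier_vec (2 * n + 1) \<and> \<psi> \<in> carrier_vec (2 * n + 1) \<and>
     (\<forall>k\<le>2 * n. \<phi> $ k - \<psi> $ k = moment \<mu> k - moment \<nu> k) \<and>
     psd (moment_matrix n \<phi>) \<and>
     moment_matrix n \<phi> \<preceq>\<^sub>L moment_matrix n (moment_vec n \<mu>) \<and>
     psd (moment_matrix n \<psi>) \<and>
     moment_matrix n \<psi> \<preceq>\<^sub>L moment_matrix n (moment_vec n \<nu>))"

definition objective :: "real Matrix.vec \<times> real Matrix.vec \<Rightarrow> real" where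
  "objective = (\<lambda>(\<phi>, \<psi>). \<phi> $ 0 + \<psi> $ 0)"

text \<open>The minimum value; it is only meaningful if a minimizer exists, i.e. if
  \<open>is_arg_min objective (feasible n \<mu> \<nu>) p\<close> for some \<open>p\<close>.\<close>

definition rho :: "nat \<Rightarrow> real measure \<Rightarrow> real measure \<Rightarrow> real" where
  "rho n \<mu> \<nu> = (LEAST r. \<exists>p. feasible n \<mu> \<nu> p \<and> r = objective p)"

end

theory Submission
  imports Defs
begin

text \<open>A feasible \<open>\<phi>\<close> is studied through its Riesz functional \<open>L\<^sub>\<phi>\<close>, the linear functional on
  polynomials with \<open>x ^ k \<mapsto> \<phi> k\<close>. The matrix inequalities say that
  \<open>0 \<le> L\<^sub>\<phi> (p\<^sup>2) \<le> \<integral>p\<^sup>2 d\<mu>\<close> for \<open>degree p \<le> n\<close>. As \<open>X = supp \<mu>\<close> has at most \<open>n\<close> points, \<open>L\<^sub>\<phi>\<close>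
  annihilates all polynomials of degree at most \<open>2n\<close> vanishing on \<open>X\<close>, hence is nonnegative
  on polynomials that are nonnegative on \<open>X\<close>. Let \<open>f\<close> of degree at most \<open>2n\<close> interpolate the sign
  of \<open>\<mu>{x} - \<nu>{x}\<close> on \<open>X \<union> Y\<close>. Then \<open>L\<^sub>\<phi> (1 - f) \<ge> 0\<close> and \<open>L\<^sub>\<psi> (1 + f) \<ge> 0\<close>, so that
  \<open>\<phi>\<^sub>0 + \<psi>\<^sub>0 \<ge> L\<^sub>\<phi> f - L\<^sub>\<psi> f = \<integral>f d(\<mu> - \<nu>)\<close>, which is the total variation norm. The Jordan
  decomposition of \<open>\<mu> - \<nu>\<close> attains this bound. For arbitrary \<open>n\<close> a minimizer exists because
  \<open>\<psi>\<close> is determined by \<open>\<phi>\<close>, and the diagonal entries of a positive semidefinite matrix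
  bound the others, which makes the feasible set compact.\<close>

section \<open>The Riesz functional\<close>

text \<open>The argument is a sequence rather than a vector, so that vector entries, moments and
  sums over atoms share one functional. Only entries up to \<open>degree p\<close> are read; for
  degrees up to \<open>2 * n\<close> the values of \<open>vec_index\<close> beyond the dimension
  have no influence.\<close>

definition riesz :: "(nat \<Rightarrow> real) \<Rightarrow> real poly \<Rightarrow> real" where
  "riesz \<phi> p = (\<Sum>k\<le>degree p. poly.coeff p k * \<phi> k)"

text \<open>Linearity needs a summation range that is not tied to \<open>degree p\<close>, since the
  degree can drop in sums.\<close>

lemma riesz_eq_sum:
  assumes "degree p \<le> n"
  shows "riesz \<phi> p = (\<Sum>k\<le>n. poly.coeff p k * \<phi> k)"
  unfolding riesz_def
  by (rule sum.mono_neutral_left) (use assms in \<open>auto simp: coeff_eq_0\<close>)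

lemma riesz_add: "riesz \<phi> (p + q) = riesz \<phi> p + riesz \<phi> q"
proof -
  let ?n = "max (degree p) (degree q)"
  show ?thesis
    by (subst (1 2 3) riesz_eq_sum[where n = ?n])
      (auto simp: degree_add_le sum.distrib algebra_simps)
qed

lemma riesz_smult: "riesz \<phi> (Polynomial.smult c p) = c * riesz \<phi> p"
  by (subst (1 2) riesz_eq_sum[where n = "degree p"])
    (auto simp: degree_smult_le sum_distrib_left mult_ac)

lemma riesz_diff: "riesz \<phi> (p - q) = riesz \<phi> p - riesz \<phi> q"
  using riesz_add[of \<phi> p "Polynomial.smult (-1) q"] riesz_smult[of \<phi> "-1" q] by simp

lemma riesz_0 [simp]: "riesz \<phi> 0 = 0"
  by (simp add: riesz_def)

lemma riesz_sum: "riesz \<phi> (\<Sum>i\<in>I. p i) = (\<Sum>i\<in>I. riesz \<phi> (p i))"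
  by (induction I rule: infinite_finite_induct) (auto simp: riesz_add)

lemma riesz_monom [simp]: "riesz \<phi> (Polynomial.monom c k) = c * \<phi> k"
  by (subst riesz_eq_sum[where n = k]) (auto simp: degree_monom_le if_distrib[of "\<lambda>c. c * _"] cong: if_cong)

lemma riesz_one [simp]: "riesz \<phi> 1 = \<phi> 0"
  by (simp add: riesz_def)

lemma riesz_diff_fun: "riesz (\<lambda>k. \<phi> k - \<chi> k) p = riesz \<phi> p - riesz \<chi> p"
  by (simp add: riesz_def algebra_simps sum_subtractf)

lemma riesz_cong:
  assumes "\<And>k. k \<le> degree p \<Longrightarrow> \<phi> k = \<chi> k"
  shows "riesz \<phi> p = riesz \<chi> p"
  using assms by (simp add: riesz_def)

lemma riesz_atoms: "riesz (\<lambda>k. \<Sum>x\<in>S. w x * x ^ k) p = (\<Sum>x\<in>S. w x * poly p x)"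
proof -
  have "riesz (\<lambda>k. \<Sum>x\<in>S. w x * x ^ k) p = (\<Sum>k\<le>degree p. \<Sum>x\<in>S. w x * (poly.coeff p k * x ^ k))"
    by (simp add: riesz_def sum_distrib_left mult_ac)
  also have "\<dots> = (\<Sum>x\<in>S. w x * poly p x)"
    by (subst sum.swap) (simp add: poly_altdef sum_distrib_left)
  finally show ?thesis .
qed

lemma riesz_mult:
  assumes "degree p \<le> n" "degree q \<le> n"
  shows "riesz \<phi> (p * q) = (\<Sum>i\<le>n. \<Sum>j\<le>n. poly.coeff p i * poly.coeff q j * \<phi> (i + j))"
proof -
  have "p * q = (\<Sum>i\<le>n. Polynomial.monom (poly.coeff p i) i) * (\<Sum>j\<le>n. Polynomial.monom (poly.coeff q j) j)"
    using assms by (simp add: poly_as_sum_of_monoms')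
  also have "\<dots> = (\<Sum>i\<le>n. \<Sum>j\<le>n. Polynomial.monom (poly.coeff p i * poly.coeff q j) (i + j))"
    by (simp add: sum_product mult_monom)
  finally show ?thesis by (simp add: riesz_sum)
qed

lemma continuous_on_riesz [continuous_intros]:
  assumes "\<And>k. continuous_on A (\<lambda>x. f x k)"
  shows "continuous_on A (\<lambda>x. riesz (f x) p)"
  unfolding riesz_def by (intro continuous_intros assms)

section \<open>Hankel quadratic forms\<close>

definition vpoly :: "nat \<Rightarrow> real Matrix.vec \<Rightarrow> real poly" where
  "vpoly n v = (\<Sum>i\<le>n. Polynomial.monom (vec_index v i) i)"

lemma coeff_vpoly: "poly.coeff (vpoly n v) i = (if i \<le> n then vec_index v i else 0)"
  by (auto simp: vpoly_def coeff_sum)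

lemma degree_vpoly: "degree (vpoly n v) \<le> n"
  by (auto simp: coeff_vpoly intro: degree_le)

lemma scalar_prod_moment_matrix:
  assumes v: "v \<in> carrier_vec (n + 1)"
  shows "scalar_prod v (moment_matrix n \<phi> *\<^sub>v v) = riesz (vec_index \<phi>) (vpoly n v * vpoly n v)"
proof -
  have "scalar_prod v (moment_matrix n \<phi> *\<^sub>v v) =
      (\<Sum>i\<le>n. \<Sum>j\<le>n. vec_index v i * (vec_index \<phi> (i + j) * vec_index v j))"
    using v
    by (simp add: scalar_prod_def moment_matrix_def sum_distrib_left
        lessThan_Suc_atMost atLeast0LessThan[symmetric] atLeast0AtMost[symmetric] atLeastLessThanSuc_atLeastAtMost)
  also have "\<dots> = riesz (vec_index \<phi>) (vpoly n v * vpoly n v)"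
    by (simp add: riesz_mult[OF degree_vpoly degree_vpoly] coeff_vpoly mult_ac)
  finally show ?thesis .
qed

text \<open>A Hankel matrix is symmetric, and \<open>vpoly n\<close> reaches every polynomial of
  degree at most \<open>n\<close>, so positivity can be tested on squares.\<close>

lemma psd_moment_matrix_iff:
  "psd (moment_matrix n \<phi>) \<longleftrightarrow> (\<forall>p. degree p \<le> n \<longrightarrow> 0 \<le> riesz (vec_index \<phi>) (p * p))"
proof
  assume L: "psd (moment_matrix n \<phi>)"
  show "\<forall>p. degree p \<le> n \<longrightarrow> 0 \<le> riesz (vec_index \<phi>) (p * p)"
  proof (intro allI impI)
    fix p :: "real poly" assume p: "degree p \<le> n"
    define v where "v = Matrix.vec (n + 1) (poly.coeff p)"
    have v: "v \<in> carrier_vec (n + 1)" by (simp add: v_def)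
    have "vpoly n v = p"
      using p by (intro poly_eqI) (auto simp: coeff_vpoly v_def coeff_eq_0)
    moreover have "0 \<le> scalar_prod v (moment_matrix n \<phi> *\<^sub>v v)"
      using L v by (simp add: psd_def moment_matrix_def)
    ultimately show "0 \<le> riesz (vec_index \<phi>) (p * p)"
      using scalar_prod_moment_matrix[OF v] by simp
  qed
next
  assume R: "\<forall>p. degree p \<le> n \<longrightarrow> 0 \<le> riesz (vec_index \<phi>) (p * p)"
  have "transpose_mat (moment_matrix n \<phi>) = moment_matrix n \<phi>"
    by (rule eq_matI) (auto simp: moment_matrix_def add.commute)
  moreover have "0 \<le> scalar_prod v (moment_matrix n \<phi> *\<^sub>v v)" if "v \<in> carrier_vec (n + 1)" for v
    using R degree_vpoly by (simp add: scalar_prod_moment_matrix[OF that])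
  ultimately show "psd (moment_matrix n \<phi>)"
    by (simp add: psd_def moment_matrix_def)
qed

text \<open>Forming Hankel matrices is linear. The carrier assumptions make vector subtraction
  entrywise on all indices up to \<open>2 * n\<close>.\<close>

lemma loewner_le_moment_matrix_iff:
  assumes "\<phi> \<in> carrier_vec (2 * n + 1)" "\<chi> \<in> carrier_vec (2 * n + 1)"
  shows "moment_matrix n \<phi> \<preceq>\<^sub>L moment_matrix n \<chi> \<longleftrightarrow>
    (\<forall>p. degree p \<le> n \<longrightarrow> riesz (vec_index \<phi>) (p * p) \<le> riesz (vec_index \<chi>) (p * p))"
proof -
  have "moment_matrix n \<chi> - moment_matrix n \<phi> = moment_matrix n (\<chi> - \<phi>)"
    by (rule eq_matI) (use assms in \<open>auto simp: moment_matrix_def\<close>)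
  moreover have "riesz (vec_index (\<chi> - \<phi>)) (p * p) =
      riesz (vec_index \<chi>) (p * p) - riesz (vec_index \<phi>) (p * p)" if "degree p \<le> n" for p
    unfolding riesz_diff_fun[symmetric]
    using assms that degree_mult_le[of p p] by (intro riesz_cong) auto
  ultimately show ?thesis
    by (auto simp: loewner_le_def psd_moment_matrix_iff) (auto simp: moment_matrix_def)
qed

text \<open>This encodes the two matrix constraints on one variable without matrices or dimensions.
  The squares have degree at most \<open>2 * n\<close>, so only entries up to that index
  count.\<close>

definition dominated :: "nat \<Rightarrow> (nat \<Rightarrow> real) \<Rightarrow> (nat \<Rightarrow> real) \<Rightarrow> bool" where
  "dominated n \<phi> \<chi> \<longleftrightarrow>
     (\<forall>p. degree p \<le> n \<longrightarrow> 0 \<le> riesz \<phi> (p * p) \<and> riesz \<phi> (p * p) \<le> riesz \<chi> (p * p))"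

lemma dominated_cong:
  assumes "\<And>k. k \<le> 2 * n \<Longrightarrow> \<phi> k = \<phi>' k" "\<And>k. k \<le> 2 * n \<Longrightarrow> \<chi> k = \<chi>' k"
  shows "dominated n \<phi> \<chi> \<longleftrightarrow> dominated n \<phi>' \<chi>'"
proof -
  have "riesz \<phi> (p * p) = riesz \<phi>' (p * p) \<and> riesz \<chi> (p * p) = riesz \<chi>' (p * p)"
    if "degree p \<le> n" for p
    using assms that degree_mult_le[of p p] by (auto intro!: riesz_cong)
  then show ?thesis unfolding dominated_def by (metis (no_types))
qed

lemma feasible_iff:
  "feasible n \<mu> \<nu> (\<phi>, \<psi>) \<longleftrightarrow>
     \<phi> \<in> carrier_vec (2 * n + 1) \<and> \<psi> \<in> carrier_vec (2 * n + 1) \<and>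
     (\<forall>k\<le>2 * n. vec_index \<phi> k - vec_index \<psi> k = moment \<mu> k - moment \<nu> k) \<and>
     dominated n (vec_index \<phi>) (moment \<mu>) \<and> dominated n (vec_index \<psi>) (moment \<nu>)"
proof -
  have mv: "moment_vec n M \<in> carrier_vec (2 * n + 1)" for M
    by (simp add: moment_vec_def)
  have "dominated n \<phi> (moment M) \<longleftrightarrow> dominated n \<phi> (vec_index (moment_vec n M))" for \<phi> M
    by (rule dominated_cong) (auto simp: moment_vec_def)
  then show ?thesis
    using loewner_le_moment_matrix_iff[OF _ mv]
    by (auto simp: feasible_def psd_moment_matrix_iff dominated_def)
qed

lemma feasible_vec:
  assumes "\<And>k. \<phi> k - \<psi> k = moment \<mu> k - moment \<nu> k"
    and "dominated n \<phi> (moment \<mu>)" "dominated n \<psi> (moment \<nu>)"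
  shows "feasible n \<mu> \<nu> (Matrix.vec (2 * n + 1) \<phi>, Matrix.vec (2 * n + 1) \<psi>)"
proof -
  have "dominated n (vec_index (Matrix.vec (2 * n + 1) \<phi>)) \<chi> \<longleftrightarrow> dominated n \<phi> \<chi>" for \<phi> \<chi>
    by (rule dominated_cong) auto
  then show ?thesis using assms by (simp add: feasible_iff)
qed

section \<open>Polynomials on a finite set\<close>

text \<open>Newton interpolation: a new node is served by adding a multiple of the product that
  vanishes at the old ones. The bound \<open>card S\<close> avoids the subtraction in
  \<open>card S - 1\<close> and suffices below.\<close>

lemma poly_interpolation:
  fixes f :: "'a::field \<Rightarrow> 'a"
  assumes "finite S"
  shows "\<exists>p. degree p \<le> card S \<and> (\<forall>x\<in>S. poly p x = f x)"
  using assms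
proof (induction S rule: finite_induct)
  case empty
  show ?case by (rule exI[of _ 0]) simp
next
  case (insert a S)
  then obtain p where p: "degree p \<le> card S" "\<forall>x\<in>S. poly p x = f x" by blast
  define w where "w = (\<Prod>x\<in>S. [:-x, 1:])"
  have w: "degree w \<le> card S"
    unfolding w_def using degree_prod_sum_le[of S "\<lambda>x. [:-x, 1:]"] insert by simp
  have wa: "poly w a \<noteq> 0"
    using insert by (auto simp: w_def poly_prod)
  have w0: "poly w x = 0" if "x \<in> S" for x
    using insert that by (auto simp: w_def poly_prod)
  define q where "q = p + Polynomial.smult ((f a - poly p a) / poly w a) w"
  have "degree q \<le> card S"
    unfolding q_def using p(1) w by (intro degree_add_le) (auto intro: order_trans[OF degree_smult_le])
  moreover have "\<forall>x\<in>insert a S. poly q x = f x"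
    using p(2) wa w0 by (auto simp: q_def)
  ultimately show ?case using insert by (auto intro!: exI[of _ q])
qed

lemma prod_linear_factors_dvd:
  fixes p :: "'a::field poly"
  assumes "finite S" "\<And>x. x \<in> S \<Longrightarrow> poly p x = 0"
  shows "(\<Prod>x\<in>S. [:-x, 1:]) dvd p"
  using assms
proof (induction S rule: finite_induct)
  case (insert a S)
  then obtain q where q: "p = (\<Prod>x\<in>S. [:-x, 1:]) * q" by (auto elim: dvdE)
  have "poly (\<Prod>x\<in>S. [:-x, 1:]) a \<noteq> 0"
    using insert by (auto simp: poly_prod)
  moreover have "poly p a = 0" using insert by simp
  ultimately have "poly q a = 0" by (simp add: q)
  then have "[:-a, 1:] dvd q" by (simp add: poly_eq_0_iff_dvd)
  then show ?case
    using insert(1,2) q by (simp add: mult_dvd_mono mult.commute[of "[:-a, 1:]"] del: mult_pCons_left mult_pCons_right)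
qed simp

lemma degree_prod_linear_factors:
  fixes S :: "'a::field set"
  shows "degree (\<Prod>x\<in>S. [:-x, 1:]) = card S"
  by (subst degree_prod_eq_sum_degree) auto

text \<open>Degenerate Cauchy-Schwarz: a vector of length zero for a positive semidefinite form is
  orthogonal to everything.\<close>

lemma riesz_mult_eq_0:
  assumes pos: "\<And>p. degree p \<le> n \<Longrightarrow> 0 \<le> riesz \<phi> (p * p)"
    and r: "degree r \<le> n" "riesz \<phi> (r * r) \<le> 0" and s: "degree s \<le> n"
  shows "riesz \<phi> (r * s) = 0"
proof (rule ccontr)
  assume nz: "riesz \<phi> (r * s) \<noteq> 0"
  \<comment> \<open>Since \<open>riesz \<phi> (r * r) = 0\<close>, the form at
    \<open>t r + s\<close> is affine in \<open>t\<close>; this choice gives it the value -1.\<close>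
  define t where "t = - (riesz \<phi> (s * s) + 1) / (2 * riesz \<phi> (r * s))"
  have rr: "riesz \<phi> (r * r) = 0" using pos[OF r(1)] r(2) by simp
  have "0 \<le> riesz \<phi> ((Polynomial.smult t r + s) * (Polynomial.smult t r + s))"
    using r(1) s by (intro pos degree_add_le) (auto intro: order_trans[OF degree_smult_le])
  also have "(Polynomial.smult t r + s) * (Polynomial.smult t r + s) = Polynomial.smult (t\<^sup>2) (r * r) + Polynomial.smult (2 * t) (r * s) + s * s"
    by (rule poly_eq_poly_eq_iff[THEN iffD1]) (simp add: fun_eq_iff algebra_simps power2_eq_square)
  also have "riesz \<phi> \<dots> = 2 * t * riesz \<phi> (r * s) + riesz \<phi> (s * s)"
    by (simp add: riesz_add riesz_smult rr)
  also have "\<dots> = -1" using nz by (simp add: t_def field_simps)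
  finally show False by simp
qed

text \<open>The polynomial vanishing on \<open>X\<close> lies in the kernel of the dominated form, so modulo that
  kernel \<open>h\<close> is the square of a polynomial interpolating \<open>sqrt h\<close> on \<open>X\<close>.\<close>

lemma dominated_riesz_nonneg:
  assumes dom: "dominated n \<phi> \<chi>" and X: "finite X" "card X \<le> n"
    and \<chi>: "\<And>p. riesz \<chi> p = (\<Sum>x\<in>X. w x * poly p x)"
    and h: "degree h \<le> 2 * n" "\<And>x. x \<in> X \<Longrightarrow> 0 \<le> poly h x"
  shows "0 \<le> riesz \<phi> h"
proof -
  define P where "P = (\<Prod>x\<in>X. [:-x, 1:])"
  have P0: "poly P x = 0" if "x \<in> X" for x
    using that X by (auto simp: P_def poly_prod)
  have Pnz: "P \<noteq> 0" by (auto simp: P_def prod_zero_iff X)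
  have dP: "degree P = card X" by (simp add: P_def degree_prod_linear_factors)
  have pos: "0 \<le> riesz \<phi> (p * p)" if "degree p \<le> n" for p
    using dom that by (simp add: dominated_def)
  have monom: "riesz \<phi> (P * Polynomial.monom 1 k) = 0" if k: "card X + k \<le> 2 * n" for k
  proof -
    \<comment> \<open>The power is split so that both \<open>P x^j\<close> and
      \<open>x^(k - j)\<close> have degree at most \<open>n\<close>, the range in which the form is
      controlled.\<close>
    define j where "j = min k (n - card X)"
    define r where "r = P * Polynomial.monom 1 j"
    define s where "s = Polynomial.monom (1::real) (k - j)"
    have r: "degree r \<le> n"
      unfolding r_def j_def using X dP
      by (intro order_trans[OF degree_mult_le]) (simp add: degree_monom_eq)
    have s: "degree s \<le> n"
      using k X by (simp add: s_def j_def degree_monom_eq)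
    have "riesz \<phi> (r * r) \<le> riesz \<chi> (r * r)"
      using dom r by (simp add: dominated_def)
    also have "\<dots> = 0" by (simp add: \<chi> r_def P0)
    finally have "riesz \<phi> (r * s) = 0"
      by (intro riesz_mult_eq_0[OF pos r _ s])
    moreover have "r * s = P * Polynomial.monom 1 k"
      by (simp add: r_def s_def mult.assoc mult_monom j_def)
    ultimately show ?thesis by simp
  qed
  obtain g where g: "degree g \<le> card X" "\<And>x. x \<in> X \<Longrightarrow> poly g x = sqrt (poly h x)"
    using poly_interpolation[OF X(1), of "\<lambda>x. sqrt (poly h x)"] by blast
  \<comment> \<open>On \<open>X\<close> the square of \<open>g\<close> equals \<open>h\<close>,
    because \<open>h\<close> is nonnegative there.\<close>
  have "P dvd h - g * g"
    unfolding P_def by (rule prod_linear_factors_dvd) (use X g h in auto)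
  then obtain q where q: "h - g * g = P * q" by (auto elim: dvdE)
  have "riesz \<phi> (P * q) = 0"
  proof (cases "q = 0")
    case False
    have "degree (P * q) \<le> 2 * n"
      unfolding q[symmetric] using h(1) g(1) X(2)
      by (intro degree_diff_le order_trans[OF degree_mult_le]) auto
    \<comment> \<open>Degrees of nonzero polynomials add, so \<open>monom\<close> covers every
      monomial of \<open>q\<close>.\<close>
    then have "card X + degree q \<le> 2 * n"
      using False Pnz by (simp add: degree_mult_eq dP)
    then have m: "riesz \<phi> (P * Polynomial.monom 1 k) = 0" if "k \<le> degree q" for k
      using that by (intro monom) simp
    have "P * q = P * (\<Sum>k\<le>degree q. Polynomial.smult (poly.coeff q k) (Polynomial.monom 1 k))"
      by (simp add: smult_monom poly_as_sum_of_monoms)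
    also have "\<dots> = (\<Sum>k\<le>degree q. Polynomial.smult (poly.coeff q k) (P * Polynomial.monom 1 k))"
      by (simp add: sum_distrib_left)
    finally show ?thesis by (simp add: riesz_sum riesz_smult m)
  qed simp
  then have "riesz \<phi> h = riesz \<phi> (g * g)"
    using riesz_diff[of \<phi> h "g * g"] by (simp add: q)
  then show ?thesis using pos[of g] g(1) X(2) by simp
qed

section \<open>Existence of a minimizer\<close>

text \<open>The squares of \<open>x^i + x^j\<close> and \<open>x^i - x^j\<close> bound the mixed
  entry by the diagonal ones. A factor 1/2 is given away.\<close>

lemma dominated_bound:
  assumes "dominated n \<phi> \<chi>" "i \<le> n" "j \<le> n"
  shows "\<bar>\<phi> (i + j)\<bar> \<le> \<chi> (i + i) + \<chi> (j + j)"
proof -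
  define p where "p c = Polynomial.monom 1 i + Polynomial.monom c j" for c :: real
  have "degree (p c) \<le> n" for c
    unfolding p_def using assms(2,3) by (intro degree_add_le order_trans[OF degree_monom_le])
  then have *: "0 \<le> riesz \<phi> (p c * p c)" for c
    using assms(1) by (simp add: dominated_def)
  have two: "riesz \<phi> (2 * q) = 2 * riesz \<phi> q" for q
    by (simp only: mult_2 riesz_add)
  have **: "riesz \<phi> (p c * p c) = \<phi> (i + i) + 2 * c * \<phi> (i + j) + c\<^sup>2 * \<phi> (j + j)" for c
    by (simp add: p_def distrib_left distrib_right mult_monom riesz_add two power2_eq_square add.commute)
  have le: "\<phi> (k + k) \<le> \<chi> (k + k)" if "k \<le> n" for k
  proof -
    have "riesz \<phi> (Polynomial.monom 1 k * Polynomial.monom 1 k)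
        \<le> riesz \<chi> (Polynomial.monom 1 k * Polynomial.monom 1 k)"
      using assms(1) that by (simp add: dominated_def degree_monom_eq)
    then show ?thesis by (simp add: mult_monom)
  qed
  have nn: "0 \<le> \<phi> (k + k)" if "k \<le> n" for k
  proof -
    have "0 \<le> riesz \<phi> (Polynomial.monom 1 k * Polynomial.monom 1 k)"
      using assms(1) that by (simp add: dominated_def degree_monom_eq)
    then show ?thesis by (simp add: mult_monom)
  qed
  from *[of 1] *[of "-1"] le[of i] le[of j] nn[of i] nn[of j] assms show ?thesis
    by (simp add: **)
qed

text \<open>Each test polynomial imposes non-strict inequalities on finite linear combinations of
  coordinates. The map \<open>f\<close> serves both the identity and the shift that recovers the
  second sequence from the first.\<close>

lemma closed_dominated:
  assumes "\<And>k. continuous_on UNIV (\<lambda>x. f x k)"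
  shows "closed {x. dominated n (f x) \<chi>}"
  unfolding dominated_def
  by (intro closed_Collect_all closed_Collect_imp closed_Collect_conj closed_Collect_le
      open_Collect_const continuous_intros assms)

text \<open>The hypotheses say that the moments of \<mu> and \<nu> themselves form a feasible
  pair.\<close>

lemma exists_minimizer:
  assumes "dominated n (moment \<mu>) (moment \<mu>)" "dominated n (moment \<nu>) (moment \<nu>)"
  shows "\<exists>p. is_arg_min objective (feasible n \<mu> \<nu>) p"
proof -
  \<comment> \<open>Every \<open>k \<le> 2 * n\<close> is the sum of two indices at most
    \<open>n\<close>, as \<open>dominated_bound\<close> requires.\<close>
  define B where "B k = moment \<mu> (k div 2 + k div 2) + moment \<mu> ((k - k div 2) + (k - k div 2))" for k
  \<comment> \<open>Coordinates beyond \<open>2 * n\<close> are pinned to 0, as the box over all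
    naturals must be compact.\<close>
  define D where "D k = (if k \<le> 2 * n then {-B k..B k} else {0})" for k
  define \<psi> where "\<psi> \<phi> k = \<phi> k + (moment \<nu> k - moment \<mu> k)" for \<phi> :: "nat \<Rightarrow> real" and k
  define K where "K = {\<phi>. dominated n \<phi> (moment \<mu>)} \<inter> {\<phi>. dominated n (\<psi> \<phi>) (moment \<nu>)} \<inter> PiE UNIV D"
  \<comment> \<open>Cutting off changes neither feasibility nor the objective, and it moves every
    competitor into the box.\<close>
  define cut where "cut \<phi> k = (if k \<le> 2 * n then \<phi> k else 0)" for \<phi> :: "nat \<Rightarrow> real" and k
  have cutK: "cut \<phi> \<in> K"
    if "dominated n \<phi> (moment \<mu>)" "dominated n \<psi>' (moment \<nu>)"
      "\<And>k. k \<le> 2 * n \<Longrightarrow> \<phi> k - \<psi>' k = moment \<mu> k - moment \<nu> k" for \<phi> \<psi>'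
  proof -
    have 1: "dominated n (cut \<phi>) (moment \<mu>)"
      using that(1) by (subst dominated_cong[where \<phi>' = \<phi> and \<chi>' = "moment \<mu>"]) (auto simp: cut_def)
    have 2: "dominated n (\<psi> (cut \<phi>)) (moment \<nu>)"
      using that(2,3) by (subst dominated_cong[where \<phi>' = \<psi>' and \<chi>' = "moment \<nu>"])
        (force simp: cut_def \<psi>_def)+
    have "\<bar>\<phi> k\<bar> \<le> B k" if "k \<le> 2 * n" for k
    proof -
      have "k div 2 \<le> n" "k - k div 2 \<le> n" "k div 2 + (k - k div 2) = k" using that by auto
      then show ?thesis
        using dominated_bound[OF \<open>dominated n \<phi> (moment \<mu>)\<close>, of "k div 2" "k - k div 2"]
        by (simp add: B_def)
    qed
    then have "cut \<phi> \<in> PiE UNIV D"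
      by (auto simp: cut_def D_def abs_le_iff minus_le_iff)
    with 1 2 show ?thesis by (simp add: K_def)
  qed
  \<comment> \<open>Tychonoff's theorem for a product of compact intervals.\<close>
  have "compactin (product_topology (\<lambda>_. euclidean) UNIV) (PiE UNIV D)"
    unfolding compactin_PiE by (auto simp: D_def)
  then have "compact (PiE UNIV D)"
    by (simp add: euclidean_product_topology)
  moreover have "closed {\<phi>. dominated n \<phi> (moment \<mu>)}"
    by (rule closed_dominated) simp
  moreover have "closed {\<phi>. dominated n (\<psi> \<phi>) (moment \<nu>)}"
    unfolding \<psi>_def by (rule closed_dominated) (intro continuous_intros continuous_on_product_coordinates)
  ultimately have "compact K"
    unfolding K_def by (intro closed_Int_compact closed_Int)
  moreover have "K \<noteq> {}"
    using cutK[OF assms] by auto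
  moreover have "continuous_on K (\<lambda>\<phi>. \<phi> 0 + \<psi> \<phi> 0)"
    unfolding \<psi>_def
    by (intro continuous_intros continuous_on_subset[OF continuous_on_product_coordinates]) auto
  ultimately obtain \<phi> where \<phi>: "\<phi> \<in> K" "\<And>\<phi>'. \<phi>' \<in> K \<Longrightarrow> \<phi> 0 + \<psi> \<phi> 0 \<le> \<phi>' 0 + \<psi> \<phi>' 0"
    using continuous_attains_inf[of K "\<lambda>\<phi>. \<phi> 0 + \<psi> \<phi> 0"] by blast
  let ?p = "(Matrix.vec (2 * n + 1) \<phi>, Matrix.vec (2 * n + 1) (\<psi> \<phi>))"
  have "feasible n \<mu> \<nu> ?p"
    using \<phi>(1) by (intro feasible_vec) (auto simp: K_def \<psi>_def)
  moreover have "objective ?p \<le> objective q" if q: "feasible n \<mu> \<nu> q" for q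
  proof -
    obtain a b where ab: "q = (a, b)" by (cases q)
    have f: "dominated n (vec_index a) (moment \<mu>)" "dominated n (vec_index b) (moment \<nu>)"
      "\<And>k. k \<le> 2 * n \<Longrightarrow> vec_index a k - vec_index b k = moment \<mu> k - moment \<nu> k"
      using q by (auto simp: ab feasible_iff)
    have "\<phi> 0 + \<psi> \<phi> 0 \<le> cut (vec_index a) 0 + \<psi> (cut (vec_index a)) 0"
      using \<phi>(2)[OF cutK[OF f]] .
    also have "\<dots> = vec_index a 0 + vec_index b 0"
      using f(3)[of 0] by (simp add: cut_def \<psi>_def)
    finally show ?thesis by (simp add: objective_def ab)
  qed
  ultimately show ?thesis
    by (auto simp: is_arg_min_linorder)
qed

section \<open>Finitely supported measures\<close>

lemma compl_finite_borel [measurable]: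
  fixes S :: "'a::t1_space set"
  shows "finite S \<Longrightarrow> - S \<in> sets borel"
  by (intro borel_open open_Compl finite_imp_closed)

text \<open>The complement is the union of all open null sets, which the Lindelof property reduces
  to a countable union.\<close>

lemma emeasure_compl_supp:
  fixes M :: "'a::second_countable_topology measure"
  assumes M: "sets M = sets borel"
  shows "emeasure M (- supp M) = 0"
proof -
  define F where "F = {U. open U \<and> emeasure M U = 0}"
  have "- supp M = \<Union>F"
    by (auto simp: supp_def F_def not_gr_zero)
  moreover obtain F' where F': "F' \<subseteq> F" "countable F'" "\<Union>F' = \<Union>F"
    using Lindelof[of F] unfolding F_def by blast
  moreover have "\<Union>F' \<in> null_sets M"
    using F'(1,2) unfolding F_def
    by (intro null_sets_UN'[of F' "\<lambda>x. x", simplified]) (auto simp: null_sets_def M)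
  ultimately show ?thesis by (simp add: null_sets_def)
qed

text \<open>Points of a finite support are isolated: some open neighbourhood of \<open>x\<close>
  meets the support only in \<open>x\<close>.\<close>

lemma singleton_supp_pos:
  fixes M :: "'a::{second_countable_topology, t1_space} measure"
  assumes M: "sets M = sets borel" and S: "finite (supp M)" and x: "x \<in> supp M"
  shows "0 < emeasure M {x}"
proof -
  have "open (- (supp M - {x}))"
    using S by (intro open_Compl finite_imp_closed) auto
  with x have "0 < emeasure M (- (supp M - {x}))" by (auto simp: supp_def)
  also have "- (supp M - {x}) = {x} \<union> - supp M" using x by auto
  also have "emeasure M \<dots> = emeasure M {x}"
    by (rule emeasure_Un_null_set)
      (use emeasure_compl_supp[OF M] S in \<open>auto simp: null_sets_def M intro: finite_imp_closed\<close>)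
  finally show ?thesis .
qed

lemma AE_in_supp_superset:
  fixes M :: "'a::{second_countable_topology, t1_space} measure"
  assumes M: "sets M = sets borel" and S: "finite S" "supp M \<subseteq> S"
  shows "AE x in M. x \<in> S"
proof (rule AE_I[of _ _ "- supp M"])
  show "{x \<in> space M. x \<notin> S} \<subseteq> - supp M" using S by auto
  show "emeasure M (- supp M) = 0" by (rule emeasure_compl_supp[OF M])
  show "- supp M \<in> sets M"
    using finite_subset[OF S(2,1)] by (simp add: M compl_finite_borel)
qed

text \<open>\<open>S\<close> may exceed the support, so that two measures can be summed over a
  common set.\<close>

lemma integral_finite_supp:
  fixes M :: "'a::{second_countable_topology, t1_space} measure" and f :: "'a \<Rightarrow> real"
  assumes "finite_measure M" and M: "sets M = sets borel" and S: "finite S" "supp M \<subseteq> S"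
    and f: "f \<in> borel_measurable borel"
  shows "(\<integral>x. f x \<partial>M) = (\<Sum>x\<in>S. measure M {x} * f x)"
proof -
  interpret finite_measure M by fact
  have [measurable_cong]: "sets M = sets borel" by fact
  have "(\<integral>x. f x \<partial>M) = (\<integral>x. (\<Sum>y\<in>S. f y * indicator {y} x) \<partial>M)"
  proof (rule integral_cong_AE)
    show "AE x in M. f x = (\<Sum>y\<in>S. f y * indicator {y} x)"
      using AE_in_supp_superset[OF M S]
      by eventually_elim (use S in \<open>auto simp: indicator_def if_distrib[of "\<lambda>c. _ * c"] cong: if_cong\<close>)
  qed (use f in measurable)
  also have "\<dots> = (\<Sum>y\<in>S. f y * measure M {y})"
    by (subst Bochner_Integration.integral_sum) (auto simp: M intro!: integrable_mult_right integrable_real_indicator simp: emeasure_finite less_top[symmetric])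
  finally show ?thesis by (simp add: mult.commute)
qed

lemma measure_finite_supp:
  fixes M :: "'a::{second_countable_topology, t1_space} measure"
  assumes "finite_measure M" and M: "sets M = sets borel" and S: "finite S" "supp M \<subseteq> S"
    and A: "A \<in> sets borel"
  shows "measure M A = (\<Sum>x\<in>S \<inter> A. measure M {x})"
proof -
  interpret finite_measure M by fact
  have "measure M A = (\<integral>x. indicator A x \<partial>M)" using A by (simp add: M)
  also have "\<dots> = (\<Sum>x\<in>S. measure M {x} * indicator A x)"
    using A by (intro integral_finite_supp assms) auto
  also have "\<dots> = (\<Sum>x\<in>S \<inter> A. measure M {x})"
    using S(1) by (simp add: sum.inter_restrict indicator_def if_distrib cong: if_cong)
  finally show ?thesis .
qed

lemma riesz_moment:
  assumes "finite_measure M" "sets M = sets borel" "finite S" "supp M \<subseteq> S"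
  shows "riesz (moment M) p = (\<Sum>x\<in>S. measure M {x} * poly p x)"
proof -
  have "moment M = (\<lambda>k. \<Sum>x\<in>S. measure M {x} * x ^ k)"
    unfolding moment_def by (intro ext integral_finite_supp assms) auto
  then show ?thesis by (simp add: riesz_atoms)
qed

text \<open>A common support point is an atom of both measures, which rules out a separating set;
  conversely, \<open>supp M\<close> separates.\<close>

lemma mutually_singular_iff_disjoint_supp:
  fixes M N :: "'a::{second_countable_topology, t1_space} measure"
  assumes M: "sets M = sets borel" "finite (supp M)" and N: "sets N = sets borel" "finite (supp N)"
  shows "mutually_singular M N \<longleftrightarrow> supp M \<inter> supp N = {}"
proof -
  have sp: "space M = UNIV" "space N = UNIV"
    using M(1) N(1) by (auto dest!: sets_eq_imp_space_eq)
  show ?thesis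
  proof
    assume "mutually_singular M N"
    then obtain A where A: "A \<in> sets M" "A \<in> sets N" "emeasure M (- A) = 0" "emeasure N A = 0"
      by (auto simp: mutually_singular_def sp Compl_eq_Diff_UNIV)
    show "supp M \<inter> supp N = {}"
    proof (rule ccontr)
      assume "supp M \<inter> supp N \<noteq> {}"
      then obtain x where x: "x \<in> supp M" "x \<in> supp N" by blast
      show False
      proof (cases "x \<in> A")
        case True
        then have "emeasure N {x} \<le> emeasure N A" using A by (intro emeasure_mono) auto
        with A singleton_supp_pos[OF N x(2)] show False by simp
      next
        case False
        then have "emeasure M {x} \<le> emeasure M (- A)"
          using A M by (intro emeasure_mono) auto
        with A singleton_supp_pos[OF M x(1)] show False by simp
      qed
    qed
  next
    assume "supp M \<inter> supp N = {}"
    then have "emeasure N (supp M) \<le> emeasure N (- supp N)"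
      using N by (intro emeasure_mono) (auto simp: compl_finite_borel)
    then show "mutually_singular M N"
      using emeasure_compl_supp[OF M(1)] emeasure_compl_supp[OF N(1)] M N
      by (auto simp: mutually_singular_def sp Compl_eq_Diff_UNIV[symmetric] intro!: exI[of _ "supp M"] borel_closed finite_imp_closed)
  qed
qed

text \<open>The set \<open>H\<close> that separates the two Jordan parts fixes the sign of the
  difference at each point of \<open>S\<close>.\<close>

lemma tv_norm_diff_finite_supp:
  fixes M N :: "'a::{second_countable_topology, t1_space} measure"
  assumes M: "finite_measure M" "sets M = sets borel" "supp M \<subseteq> S"
    and N: "finite_measure N" "sets N = sets borel" "supp N \<subseteq> S" and S: "finite S"
  shows "tv_norm_diff M N = (\<Sum>x\<in>S. \<bar>measure M {x} - measure N {x}\<bar>)"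
proof -
  obtain P Q where J: "jordan_decomposition M N P Q"
    using jordan_decomposition_exists[OF M(1) N(1)] M N by auto
  have s: "sets P = sets borel" "sets Q = sets borel"
    using J M by (auto simp: jordan_decomposition_def)
  have sp: "space M = UNIV" "space P = UNIV" "space Q = UNIV"
    using M(2) s by (auto dest!: sets_eq_imp_space_eq)
  interpret P: finite_measure P using J by (simp add: jordan_decomposition_def)
  interpret Q: finite_measure Q using J by (simp add: jordan_decomposition_def)
  have d: "measure P A - measure Q A = measure M A - measure N A" if "A \<in> sets borel" for A
    using J that M by (simp add: jordan_decomposition_def)
  obtain H where H: "H \<in> sets borel" "emeasure P (- H) = 0" "emeasure Q H = 0"
    using J by (auto simp: jordan_decomposition_def mutually_singular_def sp s Compl_eq_Diff_UNIV)
  have Q0: "measure Q A = 0" if "A \<in> sets borel" "A \<subseteq> H" for A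
    using emeasure_eq_0[of H Q A] that H s by (simp add: measure_def)
  have P0: "measure P A = 0" if "A \<in> sets borel" "A \<subseteq> - H" for A
    using emeasure_eq_0[of "- H" P A] that H s by (simp add: measure_def)
  have union: "measure L UNIV = measure L A + measure L (- A)"
    if "finite_measure L" "sets L = sets borel" "A \<in> sets borel" for L :: "'a measure" and A
    using finite_measure.finite_measure_Union[of L A "- A"] that by (simp add: Compl_partition)
  have "measure P UNIV = measure P H"
    using union[of P H] P0[of "- H"] H s P.finite_measure_axioms by simp
  also have "\<dots> = measure M H - measure N H"
    using d[of H] Q0[of H] H by simp
  also have "\<dots> = (\<Sum>x\<in>S \<inter> H. measure M {x} - measure N {x})"
    using measure_finite_supp[OF M(1,2) S M(3), of H] measure_finite_supp[OF N(1,2) S N(3), of H] H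
    by (simp add: sum_subtractf)
  \<comment> \<open>On \<open>H\<close> the part \<open>Q\<close> vanishes, so the difference at a
    point is a value of \<open>P\<close> and hence nonnegative.\<close>
  also have "\<dots> = (\<Sum>x\<in>S \<inter> H. \<bar>measure M {x} - measure N {x}\<bar>)"
  proof (rule sum.cong)
    fix x assume "x \<in> S \<inter> H"
    then show "measure M {x} - measure N {x} = \<bar>measure M {x} - measure N {x}\<bar>"
      using d[of "{x}"] Q0[of "{x}"] measure_nonneg[of P "{x}"] by simp
  qed simp
  finally have P: "measure P UNIV = (\<Sum>x\<in>S \<inter> H. \<bar>measure M {x} - measure N {x}\<bar>)" .
  have "measure Q UNIV = measure Q (- H)"
    using union[of Q H] Q0[of "H"] H s Q.finite_measure_axioms by simp
  also have "\<dots> = measure N (- H) - measure M (- H)"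
    using d[of "- H"] P0[of "- H"] H by simp
  also have "\<dots> = (\<Sum>x\<in>S \<inter> - H. measure N {x} - measure M {x})"
    using measure_finite_supp[OF M(1,2) S M(3), of "- H"] measure_finite_supp[OF N(1,2) S N(3), of "- H"] H
    by (simp add: sum_subtractf)
  also have "\<dots> = (\<Sum>x\<in>S \<inter> - H. \<bar>measure M {x} - measure N {x}\<bar>)"
  proof (rule sum.cong)
    fix x assume "x \<in> S \<inter> - H"
    then show "measure N {x} - measure M {x} = \<bar>measure M {x} - measure N {x}\<bar>"
      using d[of "{x}"] P0[of "{x}"] measure_nonneg[of Q "{x}"] by (simp del: measure_nonneg)
  qed simp
  finally have Q: "measure Q UNIV = (\<Sum>x\<in>S \<inter> - H. \<bar>measure M {x} - measure N {x}\<bar>)" .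
  have "(\<Sum>x\<in>S. \<bar>measure M {x} - measure N {x}\<bar>) = measure P UNIV + measure Q UNIV"
    unfolding P Q using S
    by (subst sum.union_disjoint[symmetric]) (auto intro!: sum.cong)
  then show ?thesis
    by (simp add: tv_norm_diff_eq[OF J] sp)
qed

section \<open>The value of the optimization problem\<close>

lemma dominated_moment_atoms:
  assumes M: "finite_measure M" "sets M = sets borel" "finite S" "supp M \<subseteq> S"
    and w: "\<And>x. 0 \<le> w x" "\<And>x. w x \<le> measure M {x}"
  shows "dominated n (\<lambda>k. \<Sum>x\<in>S. w x * x ^ k) (moment M)"
  using w by (auto simp: dominated_def riesz_atoms riesz_moment[OF M]
      intro!: sum_nonneg sum_mono mult_right_mono)

lemma rho_eq_sum:
  assumes \<mu>: "finite_measure \<mu>" "sets \<mu> = sets borel" "finite (supp \<mu>)" "card (supp \<mu>) \<le> n"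
    and \<nu>: "finite_measure \<nu>" "sets \<nu> = sets borel" "finite (supp \<nu>)" "card (supp \<nu>) \<le> n"
  defines "S \<equiv> supp \<mu> \<union> supp \<nu>"
  shows "rho n \<mu> \<nu> = (\<Sum>x\<in>S. \<bar>measure \<mu> {x} - measure \<nu> {x}\<bar>)" (is "_ = ?T")
proof -
  define d where "d x = measure \<mu> {x} - measure \<nu> {x}" for x
  have S: "finite S" "supp \<mu> \<subseteq> S" "supp \<nu> \<subseteq> S" using \<mu> \<nu> by (auto simp: S_def)
  have mom: "moment M k = (\<Sum>x\<in>S. measure M {x} * x ^ k)"
    if "finite_measure M" "sets M = sets borel" "supp M \<subseteq> S" for M k
    unfolding moment_def using that S by (intro integral_finite_supp) auto
  show ?thesis
    unfolding rho_def
  proof (rule Least_equality)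
    \<comment> \<open>These are the moments of the Jordan parts: the weights are the positive and
      negative parts of \<open>d\<close>, which stay below the point masses of \<mu> and
      \<nu>.\<close>
    define \<phi> where "\<phi> k = (\<Sum>x\<in>S. max (d x) 0 * x ^ k)" for k
    define \<psi> where "\<psi> k = (\<Sum>x\<in>S. max (- d x) 0 * x ^ k)" for k
    let ?p = "(Matrix.vec (2 * n + 1) \<phi>, Matrix.vec (2 * n + 1) \<psi>)"
    have "feasible n \<mu> \<nu> ?p"
    proof (rule feasible_vec)
      fix k
      have "\<phi> k - \<psi> k = (\<Sum>x\<in>S. d x * x ^ k)"
        by (auto simp: \<phi>_def \<psi>_def sum_subtractf[symmetric] max_def intro!: sum.cong)
      also have "\<dots> = moment \<mu> k - moment \<nu> k"
        using \<mu> \<nu> S by (simp add: mom d_def algebra_simps sum_subtractf)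
      finally show "\<phi> k - \<psi> k = moment \<mu> k - moment \<nu> k" .
    next
      show "dominated n \<phi> (moment \<mu>)"
        unfolding \<phi>_def using \<mu> S by (intro dominated_moment_atoms) (auto simp: d_def)
      show "dominated n \<psi> (moment \<nu>)"
        unfolding \<psi>_def using \<nu> S by (intro dominated_moment_atoms) (auto simp: d_def)
    qed
    moreover have "objective ?p = ?T"
      by (auto simp: objective_def \<phi>_def \<psi>_def sum.distrib[symmetric] d_def intro!: sum.cong)
    ultimately show "\<exists>p. feasible n \<mu> \<nu> p \<and> ?T = objective p" by (metis (no_types))
  next
    fix r assume "\<exists>p. feasible n \<mu> \<nu> p \<and> r = objective p"
    then obtain a b where ab: "feasible n \<mu> \<nu> (a, b)" "r = vec_index a 0 + vec_index b 0"
      by (auto simp: objective_def)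
    let ?a = "vec_index a" and ?b = "vec_index b"
    have dom: "dominated n ?a (moment \<mu>)" "dominated n ?b (moment \<nu>)"
      and diff: "\<And>k. k \<le> 2 * n \<Longrightarrow> ?a k - ?b k = moment \<mu> k - moment \<nu> k"
      using ab(1) by (auto simp: feasible_iff)
    obtain f where f: "degree f \<le> card S" "\<And>x. x \<in> S \<Longrightarrow> poly f x = sgn (d x)"
      using poly_interpolation[OF S(1), of "\<lambda>x. sgn (d x)"] by blast
    \<comment> \<open>The union of the supports has at most \<open>n + n\<close> points, which keeps
      \<open>f\<close> within reach of the moment constraints.\<close>
    have df: "degree f \<le> 2 * n"
      using f(1) card_Un_le[of "supp \<mu>" "supp \<nu>"] \<mu>(4) \<nu>(4) by (simp add: S_def)
    have f1: "\<bar>poly f x\<bar> \<le> 1" if "x \<in> S" for x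
      using f(2)[OF that] by (simp add: sgn_real_def)
    \<comment> \<open>The node set is \<open>supp \<mu>\<close> alone, which has at most
      \<open>n\<close> points; \<open>S\<close> may have more.\<close>
    have "0 \<le> riesz ?a (1 - f)"
      by (rule dominated_riesz_nonneg[OF dom(1) \<mu>(3,4) riesz_moment[OF \<mu>(1-3) subset_refl]])
        (use df f1 S in \<open>force intro: degree_diff_le\<close>)+
    moreover have "0 \<le> riesz ?b (1 + f)"
      by (rule dominated_riesz_nonneg[OF dom(2) \<nu>(3,4) riesz_moment[OF \<nu>(1-3) subset_refl]])
        (use df f1 S in \<open>force intro: degree_add_le\<close>)+
    moreover have "riesz ?a f - riesz ?b f = ?T"
    proof -
      have "riesz ?a f - riesz ?b f = riesz (moment \<mu>) f - riesz (moment \<nu>) f"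
        unfolding riesz_diff_fun[symmetric] using df diff by (intro riesz_cong) simp
      also have "\<dots> = (\<Sum>x\<in>S. d x * poly f x)"
        using riesz_moment[OF \<mu>(1,2) S(1,2)] riesz_moment[OF \<nu>(1,2) S(1,3)]
        by (simp add: d_def sum_subtractf algebra_simps)
      also have "\<dots> = ?T"
        by (rule sum.cong) (auto simp: f(2) abs_sgn d_def)
      finally show ?thesis .
    qed
    ultimately show "?T \<le> r"
      by (simp add: ab(2) riesz_diff riesz_add)
  qed
qed

text \<open>\<open>rho\<close> is a \<open>LEAST\<close>, so it denotes a minimum only where a
  minimizer exists; therefore existence is stated separately, for every \<open>n\<close>. The
  equivalence justifies reading disjoint supports as mutual singularity.\<close>

theorem theorem3p4:
  fixes \<mu> \<nu> :: "real measure"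
  assumes "real_distribution \<mu>" and "real_distribution \<nu>"
    and "finite (supp \<mu>)" and "finite (supp \<nu>)"
  shows "(\<forall>n. \<exists>p. is_arg_min objective (feasible n \<mu> \<nu>) p) \<and>
         (\<forall>n \<ge> max (card (supp \<mu>)) (card (supp \<nu>)). rho n \<mu> \<nu> = tv_norm_diff \<mu> \<nu>) \<and>
         (supp \<mu> \<inter> supp \<nu> = {} \<longleftrightarrow> mutually_singular \<mu> \<nu>) \<and>
         (supp \<mu> \<inter> supp \<nu> = {} \<longrightarrow>
            (\<forall>n \<ge> max (card (supp \<mu>)) (card (supp \<nu>)). rho n \<mu> \<nu> = 2))"
proof -
  interpret \<mu>: real_distribution \<mu> by fact
  interpret \<nu>: real_distribution \<nu> by fact
  let ?S = "supp \<mu> \<union> supp \<nu>"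
  have \<mu>: "finite_measure \<mu>" "sets \<mu> = sets borel" and \<nu>: "finite_measure \<nu>" "sets \<nu> = sets borel"
    by (simp_all add: \<mu>.finite_measure_axioms \<nu>.finite_measure_axioms)
  have self: "dominated n (moment M) (moment M)"
    if "finite_measure M" "sets M = sets borel" "finite (supp M)" for n M
    using that by (auto simp: dominated_def riesz_moment[OF that subset_refl] intro!: sum_nonneg)
  have tv: "tv_norm_diff \<mu> \<nu> = (\<Sum>x\<in>?S. \<bar>measure \<mu> {x} - measure \<nu> {x}\<bar>)"
    using assms(3,4) by (intro tv_norm_diff_finite_supp \<mu> \<nu>) auto
  have rho: "rho n \<mu> \<nu> = tv_norm_diff \<mu> \<nu>" if "n \<ge> max (card (supp \<mu>)) (card (supp \<nu>))" for n
    unfolding tv using that assms(3,4) \<mu> \<nu> by (intro rho_eq_sum) auto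
  have sing: "supp \<mu> \<inter> supp \<nu> = {} \<longleftrightarrow> mutually_singular \<mu> \<nu>"
    using mutually_singular_iff_disjoint_supp[OF \<mu>(2) assms(3) \<nu>(2) assms(4)] by simp
  have "tv_norm_diff \<mu> \<nu> = 2" if disj: "supp \<mu> \<inter> supp \<nu> = {}"
  proof -
    \<comment> \<open>Mutually singular measures are the Jordan parts of their own difference, and
      each has mass 1.\<close>
    have "jordan_decomposition \<mu> \<nu> \<mu> \<nu>"
      using \<mu> \<nu> sing disj by (simp add: jordan_decomposition_def)
    then show ?thesis
      using \<mu>.prob_space \<nu>.prob_space by (simp add: tv_norm_diff_eq)
  qed
  then show ?thesis
    using exists_minimizer[OF self self] \<mu> \<nu> assms(3,4) rho sing by simp
qed

end
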